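(* For each measurement point $x\in\Gamma_L$, the multi-frequency near field operator $\mathcal{N}_x: L^2(K)\to L^2(K)$ has the factorization $$\mathcal{N}_x = \mathcal{P}_x\, \mathcal{T}_x\, \mathcal{P}_x^{*},$$ where $\mathcal{P}_x: L^2(D)\to L^2(K)$, its adjoint $\mathcal{P}_x^*: L^2(K)\to L^2(D)$ and $\mathcal{T}_x: L^2(D)\to L^2(D)$ are the operators $$(\mathcal{P}_x\psi)(t)=\int_D e^{it|x-y|}\psi(y)\,dy,\ t\in K,\qquad (\mathcal{P}_x^*\phi)(y)=\int_K e^{-is|x-y|}\phi(s)\,ds,\ y\in D,$$ $$(\mathcal{T}_x h)(y)=\frac{f(y)}{4\pi|x-y|}\,h(y),\ y\in D.$$
   Context: Let $f\in L^2(\mathbb{R}^3)$ be a real-valued source with support $D$, where $D\subset\mathbb{R}^3$ is a bounded Lipschitz domain with connected complement $\mathbb{R}^3\setminus\overline{D}$ (so $f$ vanishes outside $\overline D$). Assume that there are constants $C_f>c_f>0$ such that either $c_f\le f(y)\le C_f$ for all $y\in D$, or $-C_f\le f(y)\le -c_f$ for all $y\in D$. Let $k_{max}>0$ and $K:=(0,k_{max}]$. Let $\Gamma_L=\{x_1,\dots,x_L\}\subset\mathbb{R}^3\setminus\overline{D}$ be a finite set of measurement points. For $k\in K$, $u^s(\cdot,k)$ denotes the unique solution of $\Delta u^s+k^2u^s=f$ in $\mathbb{R}^3$ satisfying the Sommerfeld radiation condition $\lim_{r=|x|\to\infty} r\left(\frac{\partial u^s}{\partial r}-iku^s\right)=0$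 uniformly in all directions $x/|x|$. In the paper's sign convention it is given by $$u^s(x,k)=\int_D \frac{e^{ik|x-y|}}{4\pi|x-y|}f(y)\,dy,\quad x\in\mathbb{R}^3,\ k\in K,$$ and this formula is taken as the definition of $u^s(x,k)$. For negative frequencies one sets $u^s(x,-k):=\overline{u^s(x,k)}$ for $x\in\Gamma_L$, $k\in K$. For $x\in\Gamma_L$, the multi-frequency near field operator $\mathcal{N}_x: L^2(K)\to L^2(K)$ is $$(\mathcal{N}_x g)(t):=\int_K u^s(x,t-s)\,g(s)\,ds,\quad t\in K$$ (the single value $s=t$, where $u^s(x,0)$ is not specified, is irrelevant to the integral). *)

theory Defs
  imports "HOL-Analysis.Analysis"
begin

section \<open>Square-integrable functions and operators between them\<close>

text \<open>Elements of \<open>L\<^sup>2(M)\<close> are handled through representatives; equality in \<open>L\<^sup>2(M)\<close>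
  is equality almost everywhere.\<close>

definition L2 :: "'a measure \<Rightarrow> ('a \<Rightarrow> complex) set" where
  "L2 M = {g. g \<in> borel_measurable M \<and> integrable M (\<lambda>x. (cmod (g x))\<^sup>2)}"

definition L2_inner :: "'a measure \<Rightarrow> ('a \<Rightarrow> complex) \<Rightarrow> ('a \<Rightarrow> complex) \<Rightarrow> complex" where
  "L2_inner M g h = (LINT x|M. g x * cnj (h x))"

definition L2_norm :: "'a measure \<Rightarrow> ('a \<Rightarrow> complex) \<Rightarrow> real" where
  "L2_norm M g = sqrt (LINT x|M. (cmod (g x))\<^sup>2)"

text \<open>Bounded linear operators \<open>L\<^sup>2(M) \<rightarrow> L\<^sup>2(N)\<close>, given on representatives. Linearity and
  boundedness together imply that almost everywhere equal arguments have almost everywhere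
  equal images, so such an \<open>A\<close> descends to classes.\<close>

definition L2_operator ::
  "'a measure \<Rightarrow> 'b measure \<Rightarrow> (('a \<Rightarrow> complex) \<Rightarrow> ('b \<Rightarrow> complex)) \<Rightarrow> bool" where
  "L2_operator M N A \<longleftrightarrow>
     (\<forall>g\<in>L2 M. A g \<in> L2 N) \<and>
     (\<forall>g\<in>L2 M. \<forall>h\<in>L2 M. \<forall>a b.
        AE t in N. A (\<lambda>x. a * g x + b * h x) t = a * A g t + b * A h t) \<and>
     (\<exists>C. \<forall>g\<in>L2 M. L2_norm N (A g) \<le> C * L2_norm M g)"

definition L2_adjoint ::
  "'a measure \<Rightarrow> 'b measure \<Rightarrow> (('a \<Rightarrow> complex) \<Rightarrow> ('b \<Rightarrow> complex)) \<Rightarrow>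
    (('b \<Rightarrow> complex) \<Rightarrow> ('a \<Rightarrow> complex)) \<Rightarrow> bool" where
  "L2_adjoint M N A B \<longleftrightarrow>
     (\<forall>\<psi>\<in>L2 M. \<forall>\<phi>\<in>L2 N. L2_inner N (A \<psi>) \<phi> = L2_inner M \<psi> (B \<phi>))"


section \<open>Lipschitz domains in three dimensions\<close>

text \<open>Near every boundary point, after an orthogonal change \<open>Q\<close> of coordinates, the domain is
  the region strictly above the graph of a Lipschitz function \<open>\<gamma>\<close> of the first two coordinates
  (translations are absorbed into \<open>\<gamma>\<close>).\<close>

definition lipschitz_domain :: "(real^3) set \<Rightarrow> bool" where
  "lipschitz_domain D \<longleftrightarrow>
     open D \<and> connected D \<and> D \<noteq> {} \<and>
     (\<forall>p\<in>frontier D. \<exists>r>0. \<exists>Q :: real^3 \<Rightarrow> real^3. \<exists>\<gamma> :: real^2 \<Rightarrow> real. \<exists>C.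
        orthogonal_transformation Q \<and> C-lipschitz_on UNIV \<gamma> \<and>
        D \<inter> ball p r = {y \<in> ball p r. \<gamma> (vector [Q y $ 1, Q y $ 2]) < Q y $ 3})"


section \<open>The near field and the operators\<close>

text \<open>The value at frequency \<open>0\<close> is left unspecified.\<close>

definition scattered_field ::
  "(real^3) set \<Rightarrow> (real^3 \<Rightarrow> real) \<Rightarrow> real^3 \<Rightarrow> real \<Rightarrow> complex" where
  "scattered_field D f x k =
     (let v = (\<lambda>\<kappa>::real. LINT y|lebesgue_on D.
                 exp (\<i> * of_real (\<kappa> * norm (x - y))) / of_real (4 * pi * norm (x - y)) * of_real (f y))
      in if k > 0 then v k else if k < 0 then cnj (v (- k)) else undefined)"

definition near_field_op ::
  "(real^3) set \<Rightarrow> (real^3 \<Rightarrow> real) \<Rightarrow> real set \<Rightarrow> real^3 \<Rightarrow> (real \<Rightarrow> complex) \<Rightarrow> (real \<Rightarrow> complex)" where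
  "near_field_op D f K x g t = (LINT s|lebesgue_on K. scattered_field D f x (t - s) * g s)"

definition P_op :: "(real^3) set \<Rightarrow> real^3 \<Rightarrow> (real^3 \<Rightarrow> complex) \<Rightarrow> (real \<Rightarrow> complex)" where
  "P_op D x \<psi> t = (LINT y|lebesgue_on D. exp (\<i> * of_real (t * norm (x - y))) * \<psi> y)"

definition P_adj_op :: "real set \<Rightarrow> real^3 \<Rightarrow> (real \<Rightarrow> complex) \<Rightarrow> (real^3 \<Rightarrow> complex)" where
  "P_adj_op K x \<phi> y = (LINT s|lebesgue_on K. exp (- (\<i> * of_real (s * norm (x - y)))) * \<phi> s)"

definition T_op :: "(real^3 \<Rightarrow> real) \<Rightarrow> real^3 \<Rightarrow> (real^3 \<Rightarrow> complex) \<Rightarrow> (real^3 \<Rightarrow> complex)" where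
  "T_op f x h y = of_real (f y / (4 * pi * norm (x - y))) * h y"

end

theory Submission
  imports Defs
begin

text \<open>The factorization is the identity
  \<open>exp (\<i>(t - s)r) = exp (\<i>tr) exp (-\<i>sr)\<close> with \<open>r = |x - y|\<close>, read under an integral sign.
  Because \<open>f\<close> is real, the convention \<open>u(x,-k) = cnj (u(x,k))\<close> makes one integral formula
  describe \<open>u(x,k)\<close> for every \<open>k \<noteq> 0\<close>, of either sign; the remaining case \<open>s = t\<close> is a single
  point and does not affect the integral over \<open>s\<close>. Inserting that formula in
  \<open>\<integral> u(x,t-s) g(s) ds\<close> and exchanging the order of integration leaves
  \<open>\<integral> exp (\<i>tr) (f(y) / (4\<pi>r)) (\<integral> exp (-\<i>sr) g(s) ds) dy\<close>, which is the three operators applied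
  in turn. The exchange is legitimate because the exponential has modulus one while
  \<open>f(y) / (4\<pi>r)\<close> and \<open>g\<close> are integrable over sets of finite measure
  (\<open>near_field_factorization\<close>).

  The outer two operators have bounded measurable kernels on spaces of finite measure, so
  Cauchy--Schwarz bounds them and Fubini gives the adjoint relation (locale \<open>bounded_kernel\<close>).
  The middle one multiplies by \<open>f(y) / (4\<pi>r)\<close>, which is bounded on \<open>D\<close> because \<open>f\<close> is bounded
  there and \<open>x\<close> keeps a positive distance from \<open>D\<close>. The near field operator is then bounded
  because it coincides with the product of the three.\<close>

section \<open>Square-integrable functions\<close>

lemma L2_integrable_square: "g \<in> L2 M \<Longrightarrow> integrable M (\<lambda>x. (cmod (g x))\<^sup>2)"
  and L2_measurable: "g \<in> L2 M \<Longrightarrow> g \<in> borel_measurable M"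
  by (simp_all add: L2_def)

lemma L2_norm_nonneg: "0 \<le> L2_norm M g"
  by (simp add: L2_norm_def)

lemma L2_cmult:
  assumes "g \<in> L2 M"
  shows "(\<lambda>x. a * g x) \<in> L2 M"
  using assms by (auto simp: L2_def norm_mult power_mult_distrib)

lemma L2_add:
  assumes g: "g \<in> L2 M" and h: "h \<in> L2 M"
  shows "(\<lambda>x. g x + h x) \<in> L2 M"
proof -
  have [measurable]: "g \<in> borel_measurable M" "h \<in> borel_measurable M"
    using g h by (simp_all add: L2_def)
  have "integrable M (\<lambda>x. 2 * (cmod (g x))\<^sup>2 + 2 * (cmod (h x))\<^sup>2)"
    using g h by (simp add: L2_def)
  moreover have "(cmod (a + b))\<^sup>2 \<le> 2 * (cmod a)\<^sup>2 + 2 * (cmod b)\<^sup>2" for a b :: complex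
  proof -
    have "(cmod (a + b))\<^sup>2 \<le> (cmod a + cmod b)\<^sup>2"
      by (intro power_mono norm_triangle_ineq) simp
    also have "\<dots> \<le> 2 * (cmod a)\<^sup>2 + 2 * (cmod b)\<^sup>2"
      using sum_squares_bound[of "cmod a" "cmod b"] by (simp add: power2_sum)
    finally show ?thesis .
  qed
  ultimately have "integrable M (\<lambda>x. (cmod (g x + h x))\<^sup>2)"
    by (elim Bochner_Integration.integrable_bound) auto
  then show ?thesis by (simp add: L2_def)
qed

lemma L2_lincomb:
  assumes "g \<in> L2 M" and "h \<in> L2 M"
  shows "(\<lambda>x. a * g x + b * h x) \<in> L2 M"
  using assms by (intro L2_add L2_cmult)

text \<open>On a finite measure space \<open>L\<^sup>2\<close> is contained in \<open>L\<^sup>1\<close>, so that every integral defining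
  the operators converges for all parameter values, not merely almost everywhere.\<close>

lemma (in finite_measure) L2_imp_integrable:
  assumes g: "g \<in> L2 M"
  shows "integrable M g"
proof (rule integrable_norm_cancel)
  show "g \<in> borel_measurable M" using g by (rule L2_measurable)
  show "integrable M (\<lambda>x. norm (g x))"
  proof (rule square_integrable_imp_integrable)
    show "(\<lambda>x. norm (g x)) \<in> borel_measurable M"
      using L2_measurable[OF g] by measurable
    show "integrable M (\<lambda>x. (norm (g x))\<^sup>2)" using g by (rule L2_integrable_square)
  qed
qed

text \<open>The Cauchy--Schwarz inequality against the constant function \<open>1\<close>: with \<open>m\<close> the total mass
  and \<open>a\<close> the integral of \<open>h\<close>, it is the nonnegativity of the integral of \<open>(m h - a)\<^sup>2\<close>
  (a variance, up to scaling).\<close>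

lemma (in finite_measure) square_integral_le:
  fixes h :: "'a \<Rightarrow> real"
  assumes h: "integrable M h" and h2: "integrable M (\<lambda>x. (h x)\<^sup>2)"
  shows "(LINT x|M. h x)\<^sup>2 \<le> measure M (space M) * (LINT x|M. (h x)\<^sup>2)"
proof -
  define m where "m = measure M (space M)"
  define a where "a = (LINT x|M. h x)"
  define q where "q = (LINT x|M. (h x)\<^sup>2)"
  show ?thesis
  proof (cases "m = 0")
    case True
    then have "space M \<in> null_sets M" 
      by (auto simp: m_def emeasure_eq_measure null_sets_def)
    then have "AE x in M. h x = 0" by (rule AE_I') auto
    then have "a = 0" unfolding a_def by (rule integral_eq_zero_AE)
    then show ?thesis using True by (simp add: a_def m_def)
  next
    case False
    then have m: "m > 0" by (simp add: m_def zero_less_measure_iff)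
    have "0 \<le> (LINT x|M. (m * h x - a)\<^sup>2)" by simp
    also have "\<dots> = (LINT x|M. m\<^sup>2 * (h x)\<^sup>2 - 2 * m * a * h x + a\<^sup>2)"
      by (rule arg_cong[where f="integral\<^sup>L M"])
         (auto simp: fun_eq_iff power2_eq_square algebra_simps)
    also have "\<dots> = m\<^sup>2 * q - 2 * m * a * a + a\<^sup>2 * m"
      using h h2 by (simp add: q_def a_def m_def)
    also have "\<dots> = m * (m * q - a\<^sup>2)" by (simp add: power2_eq_square algebra_simps)
    finally have "a\<^sup>2 \<le> m * q" using m by (simp add: zero_le_mult_iff)
    then show ?thesis by (simp add: a_def q_def m_def)
  qed
qed

section \<open>Operators on square-integrable functions\<close>

text \<open>Linearity reduces the claim to the difference of the two arguments, whose norm is zero; by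
  boundedness its image has norm zero as well. This is what makes operators given on
  representatives composable, since linearity of the inner one holds only almost everywhere.\<close>

lemma L2_operator_respects_AE:
  assumes A: "L2_operator M N A" and g: "g \<in> L2 M" and h: "h \<in> L2 M"
    and eq: "AE x in M. g x = h x"
  shows "AE t in N. A g t = A h t"
proof -
  define d where "d = (\<lambda>x. 1 * g x + (-1) * h x)"
  have d: "d \<in> L2 M" unfolding d_def using g h by (rule L2_lincomb)
  have Ad: "A d \<in> L2 N" using A d by (simp add: L2_operator_def)
  obtain C where C: "L2_norm N (A d) \<le> C * L2_norm M d"
    using A d unfolding L2_operator_def by blast
  have "(LINT x|M. (cmod (d x))\<^sup>2) = 0"
    using eq by (intro integral_eq_zero_AE) (auto simp: d_def)
  then have "L2_norm N (A d) = 0"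
    using C L2_norm_nonneg[of N "A d"] unfolding L2_norm_def[of M] by simp
  then have "(LINT t|N. (cmod (A d t))\<^sup>2) = 0" by (simp add: L2_norm_def)
  then have "AE t in N. (cmod (A d t))\<^sup>2 = 0"
    using integral_nonneg_eq_0_iff_AE[OF L2_integrable_square[OF Ad]] by simp
  moreover have "AE t in N. A d t = 1 * A g t + (-1) * A h t"
    using A g h unfolding L2_operator_def d_def by blast
  ultimately show ?thesis by eventually_elim simp
qed

lemma L2_operator_compose:
  assumes A: "L2_operator M N A" and B: "L2_operator N R B"
  shows "L2_operator M R (\<lambda>g. B (A g))"
  unfolding L2_operator_def
proof (intro conjI ballI allI)
  fix g assume g: "g \<in> L2 M"
  then have "A g \<in> L2 N" using A by (simp add: L2_operator_def)
  then show "B (A g) \<in> L2 R" using B by (simp add: L2_operator_def)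
next
  fix g h a b assume g: "g \<in> L2 M" and h: "h \<in> L2 M"
  have Ag: "A g \<in> L2 N" and Ah: "A h \<in> L2 N" and
    Agh: "A (\<lambda>x. a * g x + b * h x) \<in> L2 N"
    using A g h L2_lincomb[OF g h] by (auto simp: L2_operator_def)
  have "AE t in N. A (\<lambda>x. a * g x + b * h x) t = a * A g t + b * A h t"
    using A g h by (auto simp: L2_operator_def)
  then have "AE t in R. B (A (\<lambda>x. a * g x + b * h x)) t = B (\<lambda>t. a * A g t + b * A h t) t"
    by (intro L2_operator_respects_AE[OF B Agh L2_lincomb[OF Ag Ah]])
  moreover have "AE t in R. B (\<lambda>t. a * A g t + b * A h t) t = a * B (A g) t + b * B (A h) t"
    using B Ag Ah by (auto simp: L2_operator_def)
  ultimately show "AE t in R. B (A (\<lambda>x. a * g x + b * h x)) t = a * B (A g) t + b * B (A h) t"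
    by eventually_elim simp
next
  obtain C where C: "\<And>g. g \<in> L2 M \<Longrightarrow> L2_norm N (A g) \<le> C * L2_norm M g"
    using A unfolding L2_operator_def by blast
  obtain E where E: "\<And>g. g \<in> L2 N \<Longrightarrow> L2_norm R (B g) \<le> E * L2_norm N g"
    using B unfolding L2_operator_def by blast
  have "L2_norm R (B (A g)) \<le> (\<bar>E\<bar> * C) * L2_norm M g" if g: "g \<in> L2 M" for g
  proof -
    have "L2_norm R (B (A g)) \<le> E * L2_norm N (A g)"
      using A g by (intro E) (simp add: L2_operator_def)
    also have "\<dots> \<le> \<bar>E\<bar> * L2_norm N (A g)"
      by (intro mult_right_mono L2_norm_nonneg) simp
    also have "\<dots> \<le> \<bar>E\<bar> * (C * L2_norm M g)"
      by (intro mult_left_mono C g) simp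
    finally show ?thesis by simp
  qed
  then show "\<exists>C. \<forall>g\<in>L2 M. L2_norm R (B (A g)) \<le> C * L2_norm M g" by blast
qed

lemma L2_operator_cong:
  assumes A: "L2_operator M N A" and eq: "\<And>g t. g \<in> L2 M \<Longrightarrow> B g t = A g t"
  shows "L2_operator M N B"
proof -
  have "B g = A g" if "g \<in> L2 M" for g using eq[OF that] by (rule ext)
  then show ?thesis using A unfolding L2_operator_def by (simp add: L2_lincomb)
qed

lemma L2_operator_multiplication:
  fixes q :: "'a \<Rightarrow> complex"
  assumes [measurable]: "q \<in> borel_measurable M"
    and bound: "\<And>x. x \<in> space M \<Longrightarrow> cmod (q x) \<le> B"
  shows "L2_operator M M (\<lambda>h x. q x * h x)"
proof -
  have pw: "(cmod (q x * h x))\<^sup>2 \<le> B\<^sup>2 * (cmod (h x))\<^sup>2" if "x \<in> space M" for h x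
    using bound[OF that] by (simp add: norm_mult power_mult_distrib mult_right_mono power_mono)
  have mem: "(\<lambda>x. q x * h x) \<in> L2 M" if h: "h \<in> L2 M" for h
  proof -
    have [measurable]: "h \<in> borel_measurable M" using h by (rule L2_measurable)
    have "integrable M (\<lambda>x. B\<^sup>2 * (cmod (h x))\<^sup>2)" using L2_integrable_square[OF h] by simp
    then have "integrable M (\<lambda>x. (cmod (q x * h x))\<^sup>2)"
      by (rule Bochner_Integration.integrable_bound) (auto simp: pw)
    then show ?thesis by (simp add: L2_def)
  qed
  have "L2_norm M (\<lambda>x. q x * h x) \<le> \<bar>B\<bar> * L2_norm M h" if h: "h \<in> L2 M" for h
  proof -
    have "(LINT x|M. (cmod (q x * h x))\<^sup>2) \<le> (LINT x|M. B\<^sup>2 * (cmod (h x))\<^sup>2)"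
      using L2_integrable_square[OF h] L2_integrable_square[OF mem[OF h]] pw
      by (intro integral_mono) auto
    also have "\<dots> = B\<^sup>2 * (LINT x|M. (cmod (h x))\<^sup>2)" by simp
    finally show ?thesis
      unfolding L2_norm_def by (metis real_sqrt_le_iff real_sqrt_mult real_sqrt_abs)
  qed
  then show ?thesis
    unfolding L2_operator_def by (auto simp: mem distrib_left mult.left_commute)
qed

section \<open>Integral operators with bounded kernel\<close>

text \<open>The bound on \<open>k\<close> is required at all points, as it holds for the exponentials
  \<open>exp (\<i>t|x - y|)\<close>. The operator with kernel \<open>k\<close> maps functions on \<open>M\<close> to functions on \<open>N\<close>.\<close>

locale bounded_kernel = M: finite_measure M + N: finite_measure N
  for M :: "'a measure" and N :: "'b measure" +
  fixes k :: "'b \<Rightarrow> 'a \<Rightarrow> complex" and B :: real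
  assumes kernel_measurable [measurable]: "case_prod k \<in> borel_measurable (N \<Otimes>\<^sub>M M)"
    and kernel_bound: "cmod (k t s) \<le> B"
begin

lemma section_integrable:
  assumes t: "t \<in> space N" and g: "integrable M g"
  shows "integrable M (\<lambda>s. k t s * g s)"
proof -
  have [measurable]: "k t \<in> borel_measurable M"
    using measurable_compose[OF measurable_Pair1' [OF t] kernel_measurable] by simp
  have [measurable]: "g \<in> borel_measurable M" using g by auto
  have "integrable M (\<lambda>s. B * cmod (g s))" using g by simp
  then show ?thesis
  proof (rule Bochner_Integration.integrable_bound)
    show "AE s in M. cmod (k t s * g s) \<le> norm (B * cmod (g s))"
      using kernel_bound order_trans[OF norm_ge_zero kernel_bound]
      by (auto simp: norm_mult intro!: mult_right_mono)
  qed simp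
qed

text \<open>By Cauchy--Schwarz the image of \<open>g\<close> is bounded at every point by a constant times the norm
  of \<open>g\<close>; since \<open>N\<close> is finite, this pointwise bound is also a bound in \<open>L\<^sup>2(N)\<close>.\<close>

lemma L2_operator: "L2_operator M N (\<lambda>g t. LINT s|M. k t s * g s)" (is "L2_operator M N ?A")
proof -
  define c where "c = B\<^sup>2 * measure M (space M)"
  have c: "0 \<le> c" by (simp add: c_def)
  have pw: "(cmod (?A g t))\<^sup>2 \<le> c * (L2_norm M g)\<^sup>2"
    if g: "g \<in> L2 M" and t: "t \<in> space N" for g t
  proof -
    have gi: "integrable M g" using g by (rule M.L2_imp_integrable)
    have "cmod (?A g t) \<le> (LINT s|M. cmod (k t s * g s))" by (rule integral_norm_bound)
    also have "\<dots> \<le> (LINT s|M. B * cmod (g s))"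
    proof (rule integral_mono)
      show "integrable M (\<lambda>s. cmod (k t s * g s))"
        using section_integrable[OF t gi] by (rule integrable_norm)
      show "integrable M (\<lambda>s. B * cmod (g s))" using gi by simp
    qed (simp add: norm_mult mult_right_mono kernel_bound)
    finally have "(cmod (?A g t))\<^sup>2 \<le> (B * (LINT s|M. cmod (g s)))\<^sup>2"
      by (intro power_mono) auto
    also have "\<dots> \<le> B\<^sup>2 * (measure M (space M) * (LINT s|M. (cmod (g s))\<^sup>2))"
      unfolding power_mult_distrib using gi L2_integrable_square[OF g]
      by (intro mult_left_mono M.square_integral_le) auto
    finally show ?thesis by (simp add: c_def L2_norm_def)
  qed
  have mem: "?A g \<in> L2 N" if g: "g \<in> L2 M" for g
  proof -
    have [measurable]: "g \<in> borel_measurable M" using g by (rule L2_measurable)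
    have m [measurable]: "?A g \<in> borel_measurable N" by measurable
    have "integrable N (\<lambda>t. (cmod (?A g t))\<^sup>2)"
      using pw[OF g] by (intro N.integrable_const_bound[where B="c * (L2_norm M g)\<^sup>2"]) auto
    then show ?thesis by (simp add: L2_def)
  qed
  have "L2_norm N (?A g) \<le> sqrt (c * measure N (space N)) * L2_norm M g" if g: "g \<in> L2 M" for g
  proof -
    have "(LINT t|N. (cmod (?A g t))\<^sup>2) \<le> (LINT t|N. c * (L2_norm M g)\<^sup>2)"
      using L2_integrable_square[OF mem[OF g]] pw[OF g] by (intro integral_mono) auto
    also have "\<dots> = c * measure N (space N) * (L2_norm M g)\<^sup>2" by simp
    finally show ?thesis
      unfolding L2_norm_def[of N]
      by (metis real_sqrt_le_iff real_sqrt_mult real_sqrt_unique L2_norm_nonneg)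
  qed
  moreover have "?A (\<lambda>s. a * g s + b * h s) t = a * ?A g t + b * ?A h t"
    if "g \<in> L2 M" "h \<in> L2 M" and t: "t \<in> space N" for g h a b t
  proof -
    have "integrable M (\<lambda>s. k t s * g s)" "integrable M (\<lambda>s. k t s * h s)"
      using that section_integrable M.L2_imp_integrable by blast+
    then have "(LINT s|M. a * (k t s * g s) + b * (k t s * h s)) = a * ?A g t + b * ?A h t"
      by simp
    then show ?thesis by (simp add: algebra_simps)
  qed
  ultimately show ?thesis
    unfolding L2_operator_def using mem by (auto intro!: AE_I2)
qed

text \<open>The double integrand is dominated by \<open>B |u(t)| |v(s)|\<close>, which is integrable on the product,
  so Fubini applies. This exchange gives both the adjoint relation and the factorization of the
  near field operator.\<close>

lemma Fubini_kernel:
  assumes v: "integrable M v" and u: "integrable N u"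
  shows "(LINT t|N. (LINT s|M. k t s * v s) * u t) = (LINT s|M. v s * (LINT t|N. k t s * u t))"
proof -
  interpret NM: pair_sigma_finite N M ..
  have [measurable]: "v \<in> borel_measurable M" "u \<in> borel_measurable N" using u v by auto
  have uv: "integrable (N \<Otimes>\<^sub>M M) (\<lambda>p. B * cmod (u (fst p) * v (snd p)))"
  proof (rule NM.Fubini_integrable)
    show "integrable N (\<lambda>t. LINT s|M. norm (B * cmod (u (fst (t, s)) * v (snd (t, s)))))"
      using u v by (simp add: norm_mult abs_mult)
    show "AE t in N. integrable M (\<lambda>s. B * cmod (u (fst (t, s)) * v (snd (t, s))))"
      using v by (simp add: norm_mult)
  qed measurable
  have "integrable (N \<Otimes>\<^sub>M M) (\<lambda>(t, s). k t s * v s * u t)"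
    using uv
  proof (rule Bochner_Integration.integrable_bound)
    show "AE p in N \<Otimes>\<^sub>M M. norm (case p of (t, s) \<Rightarrow> k t s * v s * u t)
        \<le> norm (B * cmod (u (fst p) * v (snd p)))"
      using order_trans[OF norm_ge_zero kernel_bound]
      by (intro AE_I2)
        (auto simp: norm_mult abs_mult mult.assoc mult.commute[of "cmod (v _)"]
          intro!: mult_right_mono kernel_bound)
  qed measurable
  from NM.Fubini_integral[OF this]
  have "(LINT t|N. LINT s|M. k t s * v s * u t) = (LINT s|M. LINT t|N. v s * (k t s * u t))"
    by (simp add: mult_ac)
  then show ?thesis by simp
qed

lemma L2_adjoint:
  "L2_adjoint M N (\<lambda>g t. LINT s|M. k t s * g s) (\<lambda>h s. LINT t|N. cnj (k t s) * h t)"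
  unfolding L2_adjoint_def
proof (intro ballI)
  fix \<psi> \<phi> assume "\<psi> \<in> L2 M" and "\<phi> \<in> L2 N"
  then have "integrable M \<psi>" "integrable N (\<lambda>t. cnj (\<phi> t))"
    using M.L2_imp_integrable N.L2_imp_integrable by auto
  from Fubini_kernel[OF this]
  show "L2_inner N (\<lambda>t. LINT s|M. k t s * \<psi> s) \<phi> =
      L2_inner M \<psi> (\<lambda>s. LINT t|N. cnj (k t s) * \<phi> t)"
    unfolding L2_inner_def Bochner_Integration.integral_cnj[symmetric]
    by (simp del: Bochner_Integration.integral_cnj)
qed

end

section \<open>Factorization of the near field operator\<close>

text \<open>The affine phase \<open>a + b s\<close> covers two uses: \<open>a = 0, b = 1\<close> is the kernel of \<open>P_op\<close>, and
  \<open>a = t, b = -1\<close> is the kernel \<open>exp (\<i>(t - s)|x - y|)\<close> of the near field at a fixed \<open>t\<close>.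
  Joint measurability is clear for Borel sets, and Lebesgue measure only adds measurable sets
  in each factor.\<close>

lemma bounded_kernel_exp_norm:
  fixes x :: "'a::euclidean_space" and a b c :: real
  assumes D: "D \<in> lmeasurable" and K: "K \<in> lmeasurable"
  shows "bounded_kernel (lebesgue_on D) (lebesgue_on K)
    (\<lambda>s y. exp (\<i> * of_real ((a + b * s) * norm (x - y)))) 1"
proof -
  interpret D: finite_measure "lebesgue_on D" using D by (rule finite_measure_lebesgue_on)
  interpret K: finite_measure "lebesgue_on K" using K by (rule finite_measure_lebesgue_on)
  have [measurable]: "(\<lambda>y. y) \<in> lebesgue_on D \<rightarrow>\<^sub>M borel" "(\<lambda>s. s) \<in> lebesgue_on K \<rightarrow>\<^sub>M borel"
    using id_borel_measurable_lebesgue_on by (auto simp: id_def)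
  show ?thesis
  proof
    show "(\<lambda>(s, y). exp (\<i> * of_real ((a + b * s) * norm (x - y))))
        \<in> borel_measurable (lebesgue_on K \<Otimes>\<^sub>M lebesgue_on D)"
      by measurable
  qed simp
qed

lemma bounded_kernel_swap:
  assumes "bounded_kernel M N k B"
  shows "bounded_kernel N M (\<lambda>s t. cnj (k t s)) B"
proof -
  interpret bounded_kernel M N k B by fact
  show ?thesis
  proof
    have [measurable]: "(\<lambda>p. k (snd p) (fst p)) \<in> borel_measurable (M \<Otimes>\<^sub>M N)"
      using measurable_pair_swap[OF kernel_measurable] by (simp add: case_prod_beta)
    have "(\<lambda>p. cnj (k (snd p) (fst p))) \<in> borel_measurable (M \<Otimes>\<^sub>M N)"
      by (rule measurable_compose[where g=cnj and N=borel])
        (auto intro!: borel_measurable_continuous_onI continuous_intros)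
    then show "(\<lambda>(s, t). cnj (k t s)) \<in> borel_measurable (M \<Otimes>\<^sub>M N)"
      by (simp add: case_prod_beta)
  qed (simp add: kernel_bound)
qed

text \<open>For negative \<open>k\<close> the conjugation turns the phase \<open>-k\<close> into \<open>k\<close> and fixes the real
  factor \<open>f(y) / (4\<pi>|x - y|)\<close>. This is where real-valuedness of the source enters.\<close>

lemma scattered_field_eq:
  assumes "k \<noteq> 0"
  shows "scattered_field D f x k =
    (LINT y|lebesgue_on D. exp (\<i> * of_real (k * norm (x - y)))
        * of_real (f y / (4 * pi * norm (x - y))))"
proof (cases "k > 0")
  case True
  then show ?thesis by (simp add: scattered_field_def)
next
  case False
  then show ?thesis
    using assms unfolding scattered_field_def Let_def Bochner_Integration.integral_cnj[symmetric]
    by (simp add: exp_cnj del: Bochner_Integration.integral_cnj)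
qed

lemma AE_lebesgue_on_neq:
  fixes t :: "'a::euclidean_space"
  assumes "K \<in> sets lebesgue"
  shows "AE s in lebesgue_on K. s \<noteq> t"
proof -
  have "AE s in lebesgue. s \<noteq> t" by (rule AE_completion[OF AE_lborel_singleton])
  then show ?thesis using assms by (auto simp: AE_restrict_space_iff)
qed

text \<open>The identity holds at every \<open>t\<close>, not only at almost every one: for fixed \<open>t\<close> the unspecified
  frequency is met only at \<open>s = t\<close>.\<close>

lemma near_field_factorization:
  assumes D: "D \<in> lmeasurable" and K: "K \<in> lmeasurable"
    and q: "integrable (lebesgue_on D) (\<lambda>y. f y / (4 * pi * norm (x - y)))"
    and g: "g \<in> L2 (lebesgue_on K)"
  shows "near_field_op D f K x g t = P_op D x (T_op f x (P_adj_op K x g)) t"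
proof -
  let ?r = "\<lambda>y. norm (x - y)"
  let ?q = "\<lambda>y. of_real (f y / (4 * pi * ?r y)) :: complex"
  let ?k = "\<lambda>s y. exp (\<i> * of_real ((t - s) * ?r y))"
  interpret bounded_kernel "lebesgue_on D" "lebesgue_on K" ?k 1
    using bounded_kernel_exp_norm[OF D K, of t "-1" x] by simp
  have "near_field_op D f K x g t =
      (LINT s|lebesgue_on K. (LINT y|lebesgue_on D. ?k s y * ?q y) * g s)"
    unfolding near_field_op_def
  proof (rule Bochner_Integration.integral_cong_AE)
    have [measurable]: "g \<in> borel_measurable (lebesgue_on K)" using g by (rule L2_measurable)
    have [measurable]: "?q \<in> borel_measurable (lebesgue_on D)"
      using borel_measurable_integrable[OF q] by measurable
    have [measurable]: "(\<lambda>s. s) \<in> lebesgue_on K \<rightarrow>\<^sub>M borel"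
      using id_borel_measurable_lebesgue_on by (auto simp: id_def)
    show v: "(\<lambda>s. (LINT y|lebesgue_on D. ?k s y * ?q y) * g s) \<in> borel_measurable (lebesgue_on K)"
      by measurable
    \<comment> \<open>The unspecified value at frequency \<open>0\<close> is one constant, seen only at the point \<open>s = t\<close>.\<close>
    have "scattered_field D f x (t - s) * g s =
        (if s = t then scattered_field D f x 0 * g s
         else (LINT y|lebesgue_on D. ?k s y * ?q y) * g s)" for s
      by (simp add: scattered_field_eq)
    with v show "(\<lambda>s. scattered_field D f x (t - s) * g s) \<in> borel_measurable (lebesgue_on K)"
      by simp
    show "AE s in lebesgue_on K. scattered_field D f x (t - s) * g s
        = (LINT y|lebesgue_on D. ?k s y * ?q y) * g s"
      using AE_lebesgue_on_neq[of K t, OF fmeasurableD[OF K]]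
      by eventually_elim (simp add: scattered_field_eq)
  qed
  also have "\<dots> = (LINT y|lebesgue_on D. ?q y * (LINT s|lebesgue_on K. ?k s y * g s))"
    by (rule Fubini_kernel[OF integrable_of_real[OF q] N.L2_imp_integrable[OF g]])
  also have "\<dots> = P_op D x (T_op f x (P_adj_op K x g)) t"
  proof -
    have "?k s y = exp (\<i> * of_real (t * ?r y)) * exp (- (\<i> * of_real (s * ?r y)))" for s y
      by (simp add: left_diff_distrib right_diff_distrib flip: exp_add)
    then have "(LINT s|lebesgue_on K. ?k s y * g s) = exp (\<i> * of_real (t * ?r y)) * P_adj_op K x g y"
      for y
      by (simp only: P_adj_op_def mult.assoc integral_mult_right_zero)
    then show ?thesis
      by (simp add: P_op_def T_op_def mult_ac)
  qed
  finally show ?thesis .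
qed

theorem theorem3p1:
  fixes D :: "(real^3) set" and f :: "real^3 \<Rightarrow> real" and c_f C_f k_max :: real
    and K :: "real set" and \<Gamma> :: "(real^3) set" and x :: "real^3"
  assumes "bounded D" and "lipschitz_domain D" and "connected (- closure D)"
    and "f \<in> borel_measurable lebesgue" and "integrable lebesgue (\<lambda>y. (f y)\<^sup>2)"
    and "closure {y. f y \<noteq> 0} = closure D"
    and "0 < c_f" and "c_f < C_f"
    and "(\<forall>y\<in>D. c_f \<le> f y \<and> f y \<le> C_f) \<or> (\<forall>y\<in>D. - C_f \<le> f y \<and> f y \<le> - c_f)"
    and "0 < k_max" and "K = {0<..k_max}"
    and "finite \<Gamma>" and "\<Gamma> \<subseteq> - closure D" and "x \<in> \<Gamma>"
  shows "L2_operator (lebesgue_on K) (lebesgue_on K) (near_field_op D f K x)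
    \<and> L2_operator (lebesgue_on D) (lebesgue_on K) (P_op D x)
    \<and> L2_operator (lebesgue_on K) (lebesgue_on D) (P_adj_op K x)
    \<and> L2_adjoint (lebesgue_on D) (lebesgue_on K) (P_op D x) (P_adj_op K x)
    \<and> L2_operator (lebesgue_on D) (lebesgue_on D) (T_op f x)
    \<and> (\<forall>g\<in>L2 (lebesgue_on K). AE t in lebesgue_on K.
          near_field_op D f K x g t = P_op D x (T_op f x (P_adj_op K x g)) t)"
proof -
  let ?q = "\<lambda>y. f y / (4 * pi * norm (x - y))"
  have "open D" using \<open>lipschitz_domain D\<close> by (simp add: lipschitz_domain_def)
  then have D: "D \<in> lmeasurable" using \<open>bounded D\<close> by (intro lmeasurable_open)
  have K: "K \<in> lmeasurable" using \<open>K = {0<..k_max}\<close> by (simp add: bounded_set_imp_lmeasurable)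
  have "x \<notin> closure D" using \<open>x \<in> \<Gamma>\<close> \<open>\<Gamma> \<subseteq> - closure D\<close> by auto
  then obtain \<delta> where \<delta>: "\<delta> > 0" "\<And>y. y \<in> D \<Longrightarrow> \<delta> \<le> norm (x - y)"
    using separate_point_closed[of "closure D" x] closure_subset[of D] by (force simp: dist_norm)
  have f: "\<bar>f y\<bar> \<le> C_f" if "y \<in> D" for y
    using assms(9) that \<open>0 < c_f\<close> by fastforce
  have bound: "\<bar>?q y\<bar> \<le> C_f / (4 * pi * \<delta>)" if "y \<in> D" for y
    using f[OF that] \<delta>(2)[OF that] \<delta>(1) pi_gt_zero
    by (auto simp: abs_mult intro!: frac_le)
  have [measurable]: "f \<in> borel_measurable (lebesgue_on D)"
    using \<open>f \<in> borel_measurable lebesgue\<close> by (rule measurable_restrict_space1)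
  have [measurable]: "(\<lambda>y. y) \<in> lebesgue_on D \<rightarrow>\<^sub>M borel"
    using id_borel_measurable_lebesgue_on by (auto simp: id_def)
  have q: "?q \<in> borel_measurable (lebesgue_on D)" by measurable
  interpret D: finite_measure "lebesgue_on D" using D by (rule finite_measure_lebesgue_on)
  have qi: "integrable (lebesgue_on D) ?q"
    using q bound by (intro D.integrable_const_bound[where B="C_f / (4 * pi * \<delta>)"]) auto

  interpret P: bounded_kernel "lebesgue_on D" "lebesgue_on K"
      "\<lambda>t y. exp (\<i> * of_real (t * norm (x - y)))" 1
    using bounded_kernel_exp_norm[OF D K, of 0 1 x] by simp
  interpret Q: bounded_kernel "lebesgue_on K" "lebesgue_on D"
      "\<lambda>y s. cnj (exp (\<i> * of_real (s * norm (x - y))))" 1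
    by (rule bounded_kernel_swap) (rule P.bounded_kernel_axioms)
  have P_eq: "P_op D x = (\<lambda>\<psi> t. LINT y|lebesgue_on D. exp (\<i> * of_real (t * norm (x - y))) * \<psi> y)"
    by (simp add: fun_eq_iff P_op_def)
  have Q_eq: "P_adj_op K x =
      (\<lambda>\<phi> y. LINT s|lebesgue_on K. cnj (exp (\<i> * of_real (s * norm (x - y)))) * \<phi> s)"
    by (simp add: fun_eq_iff P_adj_op_def exp_cnj)
  have P: "L2_operator (lebesgue_on D) (lebesgue_on K) (P_op D x)"
    unfolding P_eq by (rule P.L2_operator)
  have Q: "L2_operator (lebesgue_on K) (lebesgue_on D) (P_adj_op K x)"
    unfolding Q_eq by (rule Q.L2_operator)
  have adj: "L2_adjoint (lebesgue_on D) (lebesgue_on K) (P_op D x) (P_adj_op K x)"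
    unfolding P_eq Q_eq by (rule P.L2_adjoint)
  have "L2_operator (lebesgue_on D) (lebesgue_on D) (\<lambda>h y. of_real (?q y) * h y)"
    using q bound by (intro L2_operator_multiplication[where B="C_f / (4 * pi * \<delta>)"])
      (auto simp del: of_real_divide of_real_mult)
  also have "(\<lambda>h y. of_real (?q y) * h y) = T_op f x"
    by (simp add: fun_eq_iff T_op_def)
  finally have T: "L2_operator (lebesgue_on D) (lebesgue_on D) (T_op f x)" .
  have fact: "near_field_op D f K x g t = P_op D x (T_op f x (P_adj_op K x g)) t"
    if "g \<in> L2 (lebesgue_on K)" for g t
    by (rule near_field_factorization[OF D K qi that])
  have "L2_operator (lebesgue_on K) (lebesgue_on K) (\<lambda>g. P_op D x (T_op f x (P_adj_op K x g)))"
    by (rule L2_operator_compose[OF L2_operator_compose[OF Q T] P])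
  then have "L2_operator (lebesgue_on K) (lebesgue_on K) (near_field_op D f K x)"
    by (rule L2_operator_cong) (rule fact)
  then show ?thesis using P Q adj T fact by auto
qed

end
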